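(* Let $\Phi$ be a finite crystallographic root system and let $I\subseteq\Phi^+$ be an order ideal in the root poset. (a) If $\Phi$ is simply laced and $I$ is a star ideal, then $I$ is not line-closed. (b) If $\Phi$ is of type $F_4$ and $I\supseteq\hat I$, where $\hat I$ is the order ideal of all positive roots of height at most $4$, then $I$ is not line-closed.
   Context: Root systems are reduced. Let $\Phi$ be a finite crystallographic root system with positive roots $\Phi^+$ and simple roots $\Delta\subseteq\Phi^+$. Every $\gamma\in\Phi^+$ is uniquely $\gamma=\sum_{\alpha\in\Delta}\gamma_\alpha\alpha$ with nonnegative integers $\gamma_\alpha$; its height is $\sum_{\alpha\in\Delta}\gamma_\alpha$. The root poset is the partial order on $\Phi^+$ given by $\gamma\le\gamma'$ iff $\gamma_\alpha\le\gamma'_\alpha$ for all $\alpha\in\Delta$. An order ideal is a subset $I\subseteq\Phi^+$ such that $\gamma_1\in I$ and $\gamma_2<\gamma_1$ imply $\gamma_2\in I$. $\Phi$ is simply laced if its Dynkin diagram has no multiple bonds. An ideal $I\subseteq\Phi^+$ is a star ideal if there are distinct simple roots $\alpha_1,\alpha_2,\alpha_3,\alpha_4\in\Delta$ such that $\alpha_1+\alpha_2+\alpha_3$, $\alpha_1+\alpha_2+\alpha_4$ and $\alpha_2+\alpha_3+\alpha_4$ all are roots that belong to $I$. In type $F_4$ label the simple roots $\alpha_1,\alpha_2,\alpha_3,\alpha_4$ along the Dynkin diagram so that $\alpha_1,\alpha_2$ are short, $\alpha_3,\alpha_4$ are long, and the double bond joins $\alpha_2$ and $\alpha_3$. Then $\hat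 I$ is the order ideal generated by $\eta_1=\alpha_1+2\alpha_2+\alpha_3$, $\eta_2=\alpha_1+\alpha_2+\alpha_3+\alpha_4$, $\eta_3=2\alpha_2+\alpha_3+\alpha_4$. For a finite set $\mathcal{A}$ of pairwise non-parallel vectors in a Euclidean space (such as $\mathcal{A}=I$), the closure of $S\subseteq\mathcal{A}$ is $\mathrm{cl}(S)=\mathcal{A}\cap\mathrm{span}\,S$, and a flat is a subset $S$ with $\mathrm{cl}(S)=S$. A subset $S\subseteq\mathcal{A}$ is $2$-closed if $\mathrm{cl}(\{a,b\})\subseteq S$ for all $a,b\in S$. $\mathcal{A}$ is line-closed if every $2$-closed subset of $\mathcal{A}$ is a flat of $\mathcal{A}$. *)

theory Defs
  imports "HOL-Analysis.Analysis"
begin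

section \<open>Root systems\<close>

definition cartan :: "'a::euclidean_space \<Rightarrow> 'a \<Rightarrow> real" where
  "cartan \<beta> \<alpha> = 2 * (\<beta> \<bullet> \<alpha>) / (\<alpha> \<bullet> \<alpha>)"

definition root_reflection :: "'a::euclidean_space \<Rightarrow> 'a \<Rightarrow> 'a" where
  "root_reflection \<alpha> \<beta> = \<beta> - cartan \<beta> \<alpha> *\<^sub>R \<alpha>"

text \<open>Finite, reduced and crystallographic. The roots need not span the ambient space: \<open>\<Phi>\<close> is
  a root system in \<open>span \<Phi>\<close>.\<close>

definition root_system :: "'a::euclidean_space set \<Rightarrow> bool" where
  "root_system \<Phi> \<longleftrightarrow>
     finite \<Phi> \<and> 0 \<notin> \<Phi> \<and>
     (\<forall>\<alpha>\<in>\<Phi>. \<Phi> \<inter> span {\<alpha>} = {\<alpha>, - \<alpha>}) \<and>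
     (\<forall>\<alpha>\<in>\<Phi>. \<forall>\<beta>\<in>\<Phi>. root_reflection \<alpha> \<beta> \<in> \<Phi>) \<and>
     (\<forall>\<alpha>\<in>\<Phi>. \<forall>\<beta>\<in>\<Phi>. cartan \<beta> \<alpha> \<in> \<int>)"

definition positive_roots :: "'a::euclidean_space set \<Rightarrow> 'a set \<Rightarrow> 'a set" where
  "positive_roots \<Phi> \<Delta> = {\<gamma>\<in>\<Phi>. \<exists>c::'a \<Rightarrow> nat. \<gamma> = (\<Sum>\<alpha>\<in>\<Delta>. real (c \<alpha>) *\<^sub>R \<alpha>)}"

definition simple_roots :: "'a::euclidean_space set \<Rightarrow> 'a set \<Rightarrow> bool" where
  "simple_roots \<Phi> \<Delta> \<longleftrightarrow>
     \<Delta> \<subseteq> \<Phi> \<and> independent \<Delta> \<and>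
     (\<forall>\<gamma>\<in>\<Phi>. \<gamma> \<in> positive_roots \<Phi> \<Delta> \<or> - \<gamma> \<in> positive_roots \<Phi> \<Delta>)"

text \<open>For a root \<open>\<gamma>\<close>, the coefficient of \<open>\<alpha>\<close> in the expansion of \<open>\<gamma>\<close> in simple roots is
  \<open>representation \<Delta> \<gamma> \<alpha>\<close>.\<close>

definition height :: "'a::euclidean_space set \<Rightarrow> 'a \<Rightarrow> real" where
  "height \<Delta> \<gamma> = (\<Sum>\<alpha>\<in>\<Delta>. representation \<Delta> \<gamma> \<alpha>)"

definition root_le :: "'a::euclidean_space set \<Rightarrow> 'a \<Rightarrow> 'a \<Rightarrow> bool" where
  "root_le \<Delta> \<gamma> \<gamma>' \<longleftrightarrow>
     (\<forall>\<alpha>\<in>\<Delta>. representation \<Delta> \<gamma> \<alpha> \<le> representation \<Delta> \<gamma>' \<alpha>)"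

definition order_ideal :: "'a::euclidean_space set \<Rightarrow> 'a set \<Rightarrow> 'a set \<Rightarrow> bool" where
  "order_ideal \<Phi> \<Delta> I \<longleftrightarrow>
     I \<subseteq> positive_roots \<Phi> \<Delta> \<and>
     (\<forall>\<gamma>\<^sub>1\<in>I. \<forall>\<gamma>\<^sub>2\<in>positive_roots \<Phi> \<Delta>. root_le \<Delta> \<gamma>\<^sub>2 \<gamma>\<^sub>1 \<and> \<gamma>\<^sub>2 \<noteq> \<gamma>\<^sub>1 \<longrightarrow> \<gamma>\<^sub>2 \<in> I)"

definition generated_ideal :: "'a::euclidean_space set \<Rightarrow> 'a set \<Rightarrow> 'a set \<Rightarrow> 'a set" where
  "generated_ideal \<Phi> \<Delta> X = {\<gamma>\<in>positive_roots \<Phi> \<Delta>. \<exists>\<eta>\<in>X. root_le \<Delta> \<gamma> \<eta>}"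

text \<open>The number of bonds joining two distinct simple roots in the Dynkin diagram.\<close>

definition bonds :: "'a::euclidean_space \<Rightarrow> 'a \<Rightarrow> real" where
  "bonds \<alpha> \<beta> = cartan \<alpha> \<beta> * cartan \<beta> \<alpha>"

definition simply_laced :: "'a::euclidean_space set \<Rightarrow> bool" where
  "simply_laced \<Delta> \<longleftrightarrow> (\<forall>\<alpha>\<in>\<Delta>. \<forall>\<beta>\<in>\<Delta>. \<alpha> \<noteq> \<beta> \<longrightarrow> bonds \<alpha> \<beta> \<le> 1)"

definition star_ideal :: "'a::euclidean_space set \<Rightarrow> 'a set \<Rightarrow> 'a set \<Rightarrow> bool" where
  "star_ideal \<Phi> \<Delta> I \<longleftrightarrow>
     order_ideal \<Phi> \<Delta> I \<and>
     (\<exists>\<alpha>\<^sub>1\<in>\<Delta>. \<exists>\<alpha>\<^sub>2\<in>\<Delta>. \<exists>\<alpha>\<^sub>3\<in>\<Delta>. \<exists>\<alpha>\<^sub>4\<in>\<Delta>.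
        distinct [\<alpha>\<^sub>1, \<alpha>\<^sub>2, \<alpha>\<^sub>3, \<alpha>\<^sub>4] \<and>
        {\<alpha>\<^sub>1 + \<alpha>\<^sub>2 + \<alpha>\<^sub>3, \<alpha>\<^sub>1 + \<alpha>\<^sub>2 + \<alpha>\<^sub>4, \<alpha>\<^sub>2 + \<alpha>\<^sub>3 + \<alpha>\<^sub>4} \<subseteq> \<Phi> \<inter> I)"

text \<open>The Dynkin diagram is of type \<open>F\<^sub>4\<close>, labelled as the path
  \<open>\<alpha>\<^sub>1 - \<alpha>\<^sub>2 = \<alpha>\<^sub>3 - \<alpha>\<^sub>4\<close> with \<open>\<alpha>\<^sub>1, \<alpha>\<^sub>2\<close> short and \<open>\<alpha>\<^sub>3, \<alpha>\<^sub>4\<close> long.\<close>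

definition F4_labelling :: "'a::euclidean_space set \<Rightarrow> 'a \<Rightarrow> 'a \<Rightarrow> 'a \<Rightarrow> 'a \<Rightarrow> bool" where
  "F4_labelling \<Delta> \<alpha>\<^sub>1 \<alpha>\<^sub>2 \<alpha>\<^sub>3 \<alpha>\<^sub>4 \<longleftrightarrow>
     distinct [\<alpha>\<^sub>1, \<alpha>\<^sub>2, \<alpha>\<^sub>3, \<alpha>\<^sub>4] \<and> \<Delta> = {\<alpha>\<^sub>1, \<alpha>\<^sub>2, \<alpha>\<^sub>3, \<alpha>\<^sub>4} \<and>
     bonds \<alpha>\<^sub>1 \<alpha>\<^sub>2 = 1 \<and> bonds \<alpha>\<^sub>2 \<alpha>\<^sub>3 = 2 \<and> bonds \<alpha>\<^sub>3 \<alpha>\<^sub>4 = 1 \<and>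
     bonds \<alpha>\<^sub>1 \<alpha>\<^sub>3 = 0 \<and> bonds \<alpha>\<^sub>1 \<alpha>\<^sub>4 = 0 \<and> bonds \<alpha>\<^sub>2 \<alpha>\<^sub>4 = 0 \<and>
     norm \<alpha>\<^sub>1 = norm \<alpha>\<^sub>2 \<and> norm \<alpha>\<^sub>2 < norm \<alpha>\<^sub>3 \<and> norm \<alpha>\<^sub>3 = norm \<alpha>\<^sub>4"

definition F4_hat_ideal ::
    "'a::euclidean_space set \<Rightarrow> 'a set \<Rightarrow> 'a \<Rightarrow> 'a \<Rightarrow> 'a \<Rightarrow> 'a \<Rightarrow> 'a set" where
  "F4_hat_ideal \<Phi> \<Delta> \<alpha>\<^sub>1 \<alpha>\<^sub>2 \<alpha>\<^sub>3 \<alpha>\<^sub>4 =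
     generated_ideal \<Phi> \<Delta>
       {\<alpha>\<^sub>1 + 2 *\<^sub>R \<alpha>\<^sub>2 + \<alpha>\<^sub>3, \<alpha>\<^sub>1 + \<alpha>\<^sub>2 + \<alpha>\<^sub>3 + \<alpha>\<^sub>4, 2 *\<^sub>R \<alpha>\<^sub>2 + \<alpha>\<^sub>3 + \<alpha>\<^sub>4}"

section \<open>Line-closed vector configurations\<close>

definition config_closure :: "'a::euclidean_space set \<Rightarrow> 'a set \<Rightarrow> 'a set" where
  "config_closure \<A> S = \<A> \<inter> span S"

definition flat :: "'a::euclidean_space set \<Rightarrow> 'a set \<Rightarrow> bool" where
  "flat \<A> S \<longleftrightarrow> S \<subseteq> \<A> \<and> config_closure \<A> S = S"

definition two_closed :: "'a::euclidean_space set \<Rightarrow> 'a set \<Rightarrow> bool" where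
  "two_closed \<A> S \<longleftrightarrow> S \<subseteq> \<A> \<and> (\<forall>a\<in>S. \<forall>b\<in>S. config_closure \<A> {a, b} \<subseteq> S)"

definition line_closed :: "'a::euclidean_space set \<Rightarrow> bool" where
  "line_closed \<A> \<longleftrightarrow> (\<forall>S. two_closed \<A> S \<longrightarrow> flat \<A> S)"

end

theory Submission
  imports Defs
begin

text \<open>In both parts one exhibits a \<open>2\<close>-closed set whose span contains a further simple root.
  For a star with centre \<open>a\<close> and leaves \<open>b, c, d\<close>, the roots \<open>a\<close>, \<open>a + b + c\<close>, \<open>a + b + d\<close>,
  \<open>a + c + d\<close> are pairwise orthogonal, hence no line through two of them contains a third root, yet
  their span contains \<open>b\<close>. In type \<open>F\<^sub>4\<close> intersect \<open>I\<close> with the positive roots of a subsystem of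
  type \<open>A\<^sub>2 \<times> A\<^sub>2\<close> (one factor long, one short) of full rank: a plane spanned by a long and a short
  root of it contains no other positive root of \<open>F\<^sub>4\<close>, and a plane spanned by two roots of equal
  length contains only the roots of that factor.\<close>

section \<open>Planes through two vectors and a criterion against line-closure\<close>

lemma in_span_pair_iff: "v \<in> span {x, y} \<longleftrightarrow> (\<exists>p q. v = p *\<^sub>R x + q *\<^sub>R y)"
proof -
  have "v - p *\<^sub>R x = q *\<^sub>R y \<longleftrightarrow> v = p *\<^sub>R x + q *\<^sub>R y" for p q
    by (auto simp: algebra_simps)
  then show ?thesis
    by (simp add: span_breakdown_eq)
qed

text \<open>The first premise is \<open>2\<close>-closedness in coordinates. It includes
  \<open>x = y\<close>, so every application must also control the multiples of a single vector. The
  vector \<open>v\<close> shows that \<open>S\<close> is no flat.\<close>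

lemma not_line_closedI:
  assumes "\<And>x y p q. x \<in> S \<Longrightarrow> y \<in> S \<Longrightarrow> p *\<^sub>R x + q *\<^sub>R y \<in> \<A> \<Longrightarrow> p *\<^sub>R x + q *\<^sub>R y \<in> S"
    and "S \<subseteq> \<A>" "v \<in> \<A>" "v \<in> span S" "v \<notin> S"
  shows "\<not> line_closed \<A>"
proof -
  have "two_closed \<A> S"
    using assms(1,2) by (auto simp: two_closed_def config_closure_def in_span_pair_iff)
  moreover have "\<not> flat \<A> S"
    using assms(3-5) by (auto simp: flat_def config_closure_def)
  ultimately show ?thesis
    by (auto simp: line_closed_def)
qed

section \<open>Simple coefficients, positivity and root lengths\<close>

locale based_root_system =
  fixes \<Phi> \<Delta> :: "'a::euclidean_space set"
  assumes rs: "root_system \<Phi>"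
    and simple: "simple_roots \<Phi> \<Delta>"
begin

abbreviation coef :: "'a \<Rightarrow> 'a \<Rightarrow> real" where
  "coef \<equiv> representation \<Delta>"

lemma indep: "independent \<Delta>"
  and simple_root: "\<alpha> \<in> \<Delta> \<Longrightarrow> \<alpha> \<in> \<Phi>"
  and finite_simple: "finite \<Delta>"
  using simple rs finite_subset unfolding simple_roots_def root_system_def by blast+

lemma root_inner_pos: "\<alpha> \<in> \<Phi> \<Longrightarrow> 0 < \<alpha> \<bullet> \<alpha>"
  using rs unfolding root_system_def by (metis inner_gt_zero_iff)

lemma reflection_root: "\<alpha> \<in> \<Phi> \<Longrightarrow> \<beta> \<in> \<Phi> \<Longrightarrow> \<beta> - cartan \<beta> \<alpha> *\<^sub>R \<alpha> \<in> \<Phi>"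
  using rs unfolding root_system_def root_reflection_def by blast

lemma cartan_Ints: "\<alpha> \<in> \<Phi> \<Longrightarrow> \<beta> \<in> \<Phi> \<Longrightarrow> cartan \<beta> \<alpha> \<in> \<int>"
  using rs unfolding root_system_def by blast

lemma root_multiple: "\<alpha> \<in> \<Phi> \<Longrightarrow> r *\<^sub>R \<alpha> \<in> \<Phi> \<Longrightarrow> r *\<^sub>R \<alpha> = \<alpha> \<or> r *\<^sub>R \<alpha> = - \<alpha>"
  using rs unfolding root_system_def by (metis Int_iff empty_iff insert_iff
      span_base span_scale singletonI)

lemma root_minus: "\<alpha> \<in> \<Phi> \<Longrightarrow> - \<alpha> \<in> \<Phi>"
  using rs unfolding root_system_def by blast

text \<open>Positivity is defined through some family of natural coefficients. Independence of
  \<Delta> makes \<open>representation\<close> recover exactly that family.\<close>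

lemma coef_lincomb: "\<alpha> \<in> \<Delta> \<Longrightarrow> coef (\<Sum>\<beta>\<in>\<Delta>. c \<beta> *\<^sub>R \<beta>) \<alpha> = c \<alpha>"
  using indep finite_simple
  by (simp add: representation_sum representation_scale representation_basis span_base span_scale
      if_distrib[of "(*) _"] cong: if_cong)

lemma positive_root: "\<gamma> \<in> positive_roots \<Phi> \<Delta> \<Longrightarrow> \<gamma> \<in> \<Phi>"
  by (simp add: positive_roots_def)

lemma coef_positive_Nats:
  assumes "\<gamma> \<in> positive_roots \<Phi> \<Delta>" "\<alpha> \<in> \<Delta>"
  shows "coef \<gamma> \<alpha> \<in> \<nat>"
  using assms coef_lincomb by (auto simp: positive_roots_def)

lemma coef_positive_nonneg: "\<gamma> \<in> positive_roots \<Phi> \<Delta> \<Longrightarrow> \<alpha> \<in> \<Delta> \<Longrightarrow> 0 \<le> coef \<gamma> \<alpha>"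
  using coef_positive_Nats by (metis Nats_cases of_nat_0_le_iff)

lemma positive_or_minus:
  "\<gamma> \<in> \<Phi> \<Longrightarrow> \<gamma> \<in> positive_roots \<Phi> \<Delta> \<or> - \<gamma> \<in> positive_roots \<Phi> \<Delta>"
  using simple unfolding simple_roots_def by blast

lemma positive_span: "\<gamma> \<in> positive_roots \<Phi> \<Delta> \<Longrightarrow> \<gamma> \<in> span \<Delta>"
  by (auto simp: positive_roots_def intro: span_sum span_scale span_base)

lemma root_span: "\<gamma> \<in> \<Phi> \<Longrightarrow> \<gamma> \<in> span \<Delta>"
  using positive_or_minus positive_span by (metis minus_minus span_neg)

lemma root_expansion: "\<gamma> \<in> \<Phi> \<Longrightarrow> (\<Sum>\<alpha>\<in>\<Delta>. coef \<gamma> \<alpha> *\<^sub>R \<alpha>) = \<gamma>"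
  using sum_representation_eq[OF indep root_span finite_simple] by simp

lemma coef_simple: "\<alpha> \<in> \<Delta> \<Longrightarrow> coef \<alpha> \<beta> = (if \<beta> = \<alpha> then 1 else 0)"
  using representation_basis[OF indep] by auto

lemma coef_add: "v \<in> span \<Delta> \<Longrightarrow> w \<in> span \<Delta> \<Longrightarrow> coef (v + w) \<alpha> = coef v \<alpha> + coef w \<alpha>"
  and coef_diff: "v \<in> span \<Delta> \<Longrightarrow> w \<in> span \<Delta> \<Longrightarrow> coef (v - w) \<alpha> = coef v \<alpha> - coef w \<alpha>"
  and coef_minus: "v \<in> span \<Delta> \<Longrightarrow> coef (- v) \<alpha> = - coef v \<alpha>"
  and coef_scale: "v \<in> span \<Delta> \<Longrightarrow> coef (r *\<^sub>R v) \<alpha> = r * coef v \<alpha>"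
  using indep
  by (simp_all add: representation_add representation_diff representation_neg representation_scale)

lemmas coef_simps = coef_add coef_diff coef_minus coef_scale coef_simple
  span_add span_diff span_neg span_scale span_base

lemma coef_Ints: "\<gamma> \<in> \<Phi> \<Longrightarrow> \<alpha> \<in> \<Delta> \<Longrightarrow> coef \<gamma> \<alpha> \<in> \<int>"
  using positive_or_minus coef_positive_Nats coef_minus root_span
  by (metis Ints_minus Nats_subset_Ints minus_minus subsetD)

text \<open>One positive coefficient decides the sign of a root: if the negative were the positive
  root, its coefficient there would be below zero. Most non-root claims below end in a vector with
  coefficients of both signs.\<close>

lemma positiveI:
  assumes "\<gamma> \<in> \<Phi>" "\<alpha> \<in> \<Delta>" "0 < coef \<gamma> \<alpha>"
  shows "\<gamma> \<in> positive_roots \<Phi> \<Delta>"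
  using positive_or_minus[OF assms(1)] coef_positive_nonneg[of "- \<gamma>" \<alpha>] assms
    coef_minus[OF root_span]
  by fastforce

lemma root_no_mixed_signs:
  assumes "\<gamma> \<in> \<Phi>" "\<alpha> \<in> \<Delta>" "\<beta> \<in> \<Delta>" "0 < coef \<gamma> \<alpha>"
  shows "0 \<le> coef \<gamma> \<beta>"
  using positiveI coef_positive_nonneg assms by blast

lemma simple_positive: "\<alpha> \<in> \<Delta> \<Longrightarrow> \<alpha> \<in> positive_roots \<Phi> \<Delta>"
  by (rule positiveI[of _ \<alpha>]) (simp_all add: simple_root coef_simple)

lemma minus_not_positive:
  assumes "\<gamma> \<in> positive_roots \<Phi> \<Delta>"
  shows "- \<gamma> \<notin> positive_roots \<Phi> \<Delta>"
proof
  assume *: "- \<gamma> \<in> positive_roots \<Phi> \<Delta>"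
  have "coef \<gamma> \<alpha> = 0" if "\<alpha> \<in> \<Delta>" for \<alpha>
    using coef_positive_nonneg[OF assms that] coef_positive_nonneg[OF * that]
      coef_minus[OF positive_span[OF assms]] by auto
  then have "\<gamma> = 0"
    using root_expansion[OF positive_root[OF assms]] by simp
  then show False
    using root_inner_pos[OF positive_root[OF assms]] by simp
qed

text \<open>The reflection of \<beta> in \<alpha> is a root with coefficient 1 at \<beta> and minus
  the Cartan integer at \<alpha>. Since signs cannot be mixed, this Cartan integer is not
  positive.\<close>

lemma simple_obtuse:
  assumes "\<alpha> \<in> \<Delta>" "\<beta> \<in> \<Delta>" "\<alpha> \<noteq> \<beta>"
  shows "\<alpha> \<bullet> \<beta> \<le> 0"
proof -
  let ?\<gamma> = "\<beta> - cartan \<beta> \<alpha> *\<^sub>R \<alpha>"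
  have "?\<gamma> \<in> \<Phi>" "coef ?\<gamma> \<beta> = 1" "coef ?\<gamma> \<alpha> = - cartan \<beta> \<alpha>"
    using assms reflection_root simple_root by (simp_all add: coef_simps)
  then have "cartan \<beta> \<alpha> \<le> 0"
    using root_no_mixed_signs[of ?\<gamma> \<beta> \<alpha>] assms by simp
  then show ?thesis
    using root_inner_pos[OF simple_root[OF assms(1)]]
    by (simp add: cartan_def inner_commute divide_le_0_iff)
qed

text \<open>Reflecting in a simple root that makes an acute angle with \<open>\<gamma>\<close> lowers the height and
  preserves the norm.\<close>

lemma positive_root_norm:
  assumes "\<gamma> \<in> positive_roots \<Phi> \<Delta>"
  shows "\<exists>\<alpha>\<in>\<Delta>. \<gamma> \<bullet> \<gamma> = \<alpha> \<bullet> \<alpha>"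
  using assms
proof (induction "nat \<lfloor>height \<Delta> \<gamma>\<rfloor>" arbitrary: \<gamma> rule: less_induct)
  case less
  note pos = less.prems
  note root = positive_root[OF pos]
  have "\<gamma> \<bullet> \<gamma> = (\<Sum>\<alpha>\<in>\<Delta>. coef \<gamma> \<alpha> * (\<gamma> \<bullet> \<alpha>))"
    using inner_sum_right[of \<gamma> "\<lambda>\<alpha>. coef \<gamma> \<alpha> *\<^sub>R \<alpha>" \<Delta>] root_expansion[OF root] by simp
  \<comment> \<open>The terms add up to the positive number \<gamma> \<bullet> \<gamma>, so they are
    not all nonpositive.\<close>
  then have "\<exists>\<alpha>\<in>\<Delta>. 0 < coef \<gamma> \<alpha> * (\<gamma> \<bullet> \<alpha>)"
    using root_inner_pos[OF root] sum_nonpos[of \<Delta> "\<lambda>\<alpha>. coef \<gamma> \<alpha> * (\<gamma> \<bullet> \<alpha>)"]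
    by (auto simp flip: not_less)
  then obtain \<alpha> where \<alpha>: "\<alpha> \<in> \<Delta>" and acute: "0 < \<gamma> \<bullet> \<alpha>"
    using coef_positive_nonneg[OF pos] by (auto simp: zero_less_mult_iff not_less[symmetric])
  define k where "k = cartan \<gamma> \<alpha>"
  define \<gamma>' where "\<gamma>' = \<gamma> - k *\<^sub>R \<alpha>"
  have aa: "0 < \<alpha> \<bullet> \<alpha>"
    using root_inner_pos[OF simple_root[OF \<alpha>]] .
  have "0 < k"
    using acute aa by (simp add: k_def cartan_def)
  moreover have "k \<in> \<int>"
    using cartan_Ints \<alpha> root simple_root by (simp add: k_def)
  \<comment> \<open>Integrality makes the height drop by at least 1, so the measure
    \<open>nat \<lfloor>height \<Delta> \<gamma>\<rfloor>\<close> strictly decreases although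
    \<open>height\<close> is real-valued.\<close>
  ultimately have k: "1 \<le> k"
    by (auto elim!: Ints_cases)
  have root': "\<gamma>' \<in> \<Phi>"
    using reflection_root \<alpha> root simple_root by (simp add: \<gamma>'_def k_def)
  have coef': "coef \<gamma>' \<beta> = coef \<gamma> \<beta> - (if \<beta> = \<alpha> then k else 0)" for \<beta>
    using \<alpha> root by (simp add: \<gamma>'_def root_span coef_simps)
  show ?case
  \<comment> \<open>The reflection changes only the coefficient at \<alpha>. If another simple root
    occurs in \<gamma>, its positive coefficient survives and \<gamma>' is again positive; otherwise
    \<gamma> is a multiple of \<alpha>, and reducedness settles the case.\<close>
  proof (cases "\<exists>\<beta>\<in>\<Delta>. \<beta> \<noteq> \<alpha> \<and> 0 < coef \<gamma> \<beta>")
    case True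
    then have pos': "\<gamma>' \<in> positive_roots \<Phi> \<Delta>"
      using positiveI[OF root'] coef' by auto
    have "height \<Delta> \<gamma>' = height \<Delta> \<gamma> - k"
      using \<alpha> finite_simple by (simp add: height_def coef' sum_subtractf)
    moreover have "0 \<le> height \<Delta> \<gamma>'"
      using coef_positive_nonneg[OF pos'] by (simp add: height_def sum_nonneg)
    ultimately have "nat \<lfloor>height \<Delta> \<gamma>'\<rfloor> < nat \<lfloor>height \<Delta> \<gamma>\<rfloor>"
      using k by linarith
    then have "\<exists>\<alpha>\<in>\<Delta>. \<gamma>' \<bullet> \<gamma>' = \<alpha> \<bullet> \<alpha>"
      using less.hyps pos' by blast
    moreover have "\<gamma>' \<bullet> \<gamma>' = \<gamma> \<bullet> \<gamma>"
      using aa by (simp add: \<gamma>'_def k_def cartan_def inner_diff inner_commute field_simps)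
    ultimately show ?thesis by simp
  next
    case False
    then have "coef \<gamma> \<beta> *\<^sub>R \<beta> = 0" if "\<beta> \<in> \<Delta> - {\<alpha>}" for \<beta>
      using coef_positive_nonneg[OF pos, of \<beta>] that by fastforce
    then have "(\<Sum>\<beta>\<in>\<Delta> - {\<alpha>}. coef \<gamma> \<beta> *\<^sub>R \<beta>) = 0"
      by (rule sum.neutral[OF ballI])
    then have "\<gamma> = coef \<gamma> \<alpha> *\<^sub>R \<alpha>"
      using root_expansion[OF root] sum.remove[OF finite_simple \<alpha>, of "\<lambda>\<beta>. coef \<gamma> \<beta> *\<^sub>R \<beta>"]
      by simp
    then have "\<gamma> = \<alpha> \<or> \<gamma> = - \<alpha>"
      using root_multiple[OF simple_root[OF \<alpha>]] root by metis
    then show ?thesis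
      using \<alpha> by auto
  qed
qed

section \<open>Sums of simple roots and roots in an orthogonal plane\<close>

lemma orthogonal_simple_sum_not_root:
  assumes "\<alpha> \<in> \<Delta>" "\<beta> \<in> \<Delta>" "\<alpha> \<noteq> \<beta>" "\<alpha> \<bullet> \<beta> = 0"
  shows "\<alpha> + \<beta> \<notin> \<Phi>"
proof
  assume "\<alpha> + \<beta> \<in> \<Phi>"
  moreover have "cartan (\<alpha> + \<beta>) \<alpha> = 2"
    using assms root_inner_pos[OF simple_root[OF assms(1)]]
    by (simp add: cartan_def inner_add inner_commute)
  \<comment> \<open>The reflection in \<alpha> fixes \<beta> and negates \<alpha>, which produces
    mixed signs.\<close>
  ultimately have "\<beta> - \<alpha> \<in> \<Phi>"
    using reflection_root[OF simple_root[OF assms(1)], of "\<alpha> + \<beta>"] by (simp add: scaleR_2)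
  then show False
    using root_no_mixed_signs[of "\<beta> - \<alpha>" \<beta> \<alpha>] assms by (simp add: coef_simps)
qed

text \<open>A root has connected support: if \<alpha> were orthogonal to both other summands, the
  reflection in \<alpha> would only flip its sign and give the root \<beta> + \<gamma> - \<alpha>
  with mixed signs.\<close>

lemma support_connected3:
  assumes "\<alpha> \<in> \<Delta>" "\<beta> \<in> \<Delta>" "\<gamma> \<in> \<Delta>" "\<alpha> \<noteq> \<beta>" "\<alpha> \<noteq> \<gamma>"
    and sum: "\<alpha> + \<beta> + \<gamma> \<in> \<Phi>"
  shows "\<alpha> \<bullet> \<beta> < 0 \<or> \<alpha> \<bullet> \<gamma> < 0"
proof (rule ccontr)
  assume "\<not> ?thesis"
  then have "\<alpha> \<bullet> \<beta> = 0" "\<alpha> \<bullet> \<gamma> = 0"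
    using simple_obtuse assms by (meson order_antisym linorder_not_le)+
  then have "cartan (\<alpha> + \<beta> + \<gamma>) \<alpha> = 2"
    using root_inner_pos[OF simple_root[OF assms(1)]]
    by (simp add: cartan_def inner_add inner_commute)
  then have "\<beta> + \<gamma> - \<alpha> \<in> \<Phi>"
    using reflection_root[OF simple_root[OF assms(1)] sum] by (simp add: scaleR_2 algebra_simps)
  then show False
    \<comment> \<open>The hypotheses admit \<beta> = \<gamma>, where the coefficient at \<beta> is 2
      instead of 1.\<close>
    using root_no_mixed_signs[of "\<beta> + \<gamma> - \<alpha>" \<beta> \<alpha>] assms by (cases "\<beta> = \<gamma>") (simp_all add: coef_simps)
qed

text \<open>If \<open>p\<close> and \<open>q\<close> are both nonzero, the Cartan integers of
  \<open>x\<close> and \<open>y\<close> against the combination are 2p and 2q divided by the sum of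
  squares of \<open>p\<close> and \<open>q\<close>. As nonzero integers they have absolute value at
  least 1, which forces \<bar>p\<bar> = \<bar>q\<bar> = 1. Up to sign the combination is then
  \<open>x + y\<close> or \<open>x - y\<close>, and both are excluded. If one coefficient vanishes,
  reducedness applies.\<close>

lemma root_in_orthogonal_plane:
  assumes x: "x \<in> \<Phi>" and y: "y \<in> \<Phi>" and "x \<bullet> y = 0" "x \<bullet> x = y \<bullet> y"
    and "x + y \<notin> \<Phi>" "x - y \<notin> \<Phi>"
    and \<gamma>: "p *\<^sub>R x + q *\<^sub>R y \<in> \<Phi>" and pq: "p \<in> \<int>" "q \<in> \<int>"
  shows "p *\<^sub>R x + q *\<^sub>R y \<in> {x, - x, y, - y}"
proof (cases "p = 0 \<or> q = 0")
  case True
  then show ?thesis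
    using root_multiple[OF x, of p] root_multiple[OF y, of q] \<gamma> by auto
next
  case False
  let ?\<gamma> = "p *\<^sub>R x + q *\<^sub>R y"
  obtain i j where ij: "p = of_int i" "q = of_int j"
    using pq by (auto elim!: Ints_cases)
  have N: "0 < y \<bullet> y"
    using root_inner_pos[OF y] .
  have "?\<gamma> \<bullet> ?\<gamma> = (p\<^sup>2 + q\<^sup>2) * (y \<bullet> y)"
    using assms(3,4) by (simp add: inner_add inner_commute power2_eq_square algebra_simps)
  then have "cartan x ?\<gamma> = 2 * p / (p\<^sup>2 + q\<^sup>2)" "cartan y ?\<gamma> = 2 * q / (p\<^sup>2 + q\<^sup>2)"
    using assms(3,4) N by (simp_all add: cartan_def inner_add inner_commute)
  then have ints: "2 * p / (p\<^sup>2 + q\<^sup>2) \<in> \<int>" "2 * q / (p\<^sup>2 + q\<^sup>2) \<in> \<int>"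
    using cartan_Ints[OF \<gamma> x] cartan_Ints[OF \<gamma> y] by simp_all
  \<comment> \<open>A nonzero integer quotient has a numerator at least as large as its
    denominator.\<close>
  have bound: "p\<^sup>2 + q\<^sup>2 \<le> 2 * \<bar>r\<bar>" if "2 * r / (p\<^sup>2 + q\<^sup>2) \<in> \<int>" "r \<noteq> 0" for r
  proof -
    have pos: "0 < p\<^sup>2 + q\<^sup>2"
      using False by (simp add: sum_power2_gt_zero_iff)
    have "1 \<le> \<bar>2 * r / (p\<^sup>2 + q\<^sup>2)\<bar>"
      using that pos by (intro Ints_nonzero_abs_ge1) auto
    then show ?thesis
      using pos by (simp add: abs_mult)
  qed
  have "of_int (i\<^sup>2 + j\<^sup>2) \<le> (of_int (2 * \<bar>i\<bar>) :: real)"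
       "of_int (i\<^sup>2 + j\<^sup>2) \<le> (of_int (2 * \<bar>j\<bar>) :: real)"
    using bound[OF ints(1)] bound[OF ints(2)] False ij by simp_all
  then have le: "i\<^sup>2 + j\<^sup>2 \<le> 2 * \<bar>i\<bar>" "i\<^sup>2 + j\<^sup>2 \<le> 2 * \<bar>j\<bar>"
    by (simp_all only: of_int_le_iff)
  have ge1: "1 \<le> \<bar>i\<bar>" "1 \<le> \<bar>j\<bar>"
    using False ij by auto
  have sq: "r\<^sup>2 = \<bar>r\<bar> * \<bar>r\<bar>" for r :: int
    by (simp add: power2_eq_square flip: abs_mult)
  have "\<bar>i\<bar> * 1 \<le> \<bar>i\<bar> * \<bar>i\<bar>" "\<bar>j\<bar> * 1 \<le> \<bar>j\<bar> * \<bar>j\<bar>"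
    using ge1 by (intro mult_left_mono; simp)+
  then have "\<bar>i\<bar> * \<bar>i\<bar> = \<bar>i\<bar>" "\<bar>j\<bar> * \<bar>j\<bar> = \<bar>j\<bar>"
    using le unfolding sq by linarith+
  then have "\<bar>i\<bar> = 1" "\<bar>j\<bar> = 1"
    using ge1 unfolding mult_cancel_left2 by auto
  then consider "i = 1" "j = 1" | "i = 1" "j = - 1" | "i = - 1" "j = 1" | "i = - 1" "j = - 1"
    by linarith
  then have "x + y \<in> \<Phi> \<or> x - y \<in> \<Phi>"
    using \<gamma> root_minus[OF \<gamma>] unfolding ij by cases (simp_all add: add.commute)
  then show ?thesis
    using assms(5,6) by simp
qed

section \<open>Order ideals, and bonds and cycles in simply laced diagrams\<close>

lemma ideal_downward:
  assumes "order_ideal \<Phi> \<Delta> I" "\<gamma> \<in> I" "\<delta> \<in> positive_roots \<Phi> \<Delta>"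
    and "\<And>\<alpha>. \<alpha> \<in> \<Delta> \<Longrightarrow> coef \<delta> \<alpha> \<le> coef \<gamma> \<alpha>"
  shows "\<delta> \<in> I"
  using assms unfolding order_ideal_def root_le_def by blast

lemma ideal_positive: "order_ideal \<Phi> \<Delta> I \<Longrightarrow> \<gamma> \<in> I \<Longrightarrow> \<gamma> \<in> positive_roots \<Phi> \<Delta>"
  unfolding order_ideal_def by blast

lemma inner_pos_if_coef_nonzero:
  assumes "v \<in> span \<Delta>" "coef v \<alpha> \<noteq> 0"
  shows "0 < v \<bullet> v"
  using assms representation_zero[of \<Delta>] by (metis inner_gt_zero_iff)

text \<open>Both Cartan integers are negative and their product is at most 1, so both equal -1. This
  fixes the length ratio and the angle.\<close>

lemma simply_laced_bond:
  assumes "simply_laced \<Delta>" "\<alpha> \<in> \<Delta>" "\<beta> \<in> \<Delta>" "\<alpha> \<noteq> \<beta>" "\<alpha> \<bullet> \<beta> < 0"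
  shows "\<beta> \<bullet> \<beta> = \<alpha> \<bullet> \<alpha>" "\<alpha> \<bullet> \<beta> = - (\<alpha> \<bullet> \<alpha>) / 2"
proof -
  have pos: "0 < \<alpha> \<bullet> \<alpha>" "0 < \<beta> \<bullet> \<beta>"
    using assms root_inner_pos simple_root by auto
  obtain m n where mn: "cartan \<alpha> \<beta> = of_int m" "cartan \<beta> \<alpha> = of_int n"
    using cartan_Ints assms simple_root by (metis Ints_cases)
  have "cartan \<alpha> \<beta> < 0" "cartan \<beta> \<alpha> < 0"
    using pos assms by (simp_all add: cartan_def inner_commute divide_less_0_iff)
  then have neg: "m \<le> - 1" "n \<le> - 1"
    using mn by auto
  have "of_int (m * n) \<le> (1 :: real)"
    using assms(1-4) mn unfolding simply_laced_def bonds_def by (metis of_int_mult)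
  then have le: "m * n \<le> 1"
    by linarith
  \<comment> \<open>Expanded and combined with m * n \<le> 1, this gives m + n \<ge> -2, while both
    numbers are at most -1.\<close>
  have "(m + 1) * (n + 1) \<ge> 0"
    using neg by (simp add: mult_nonpos_nonpos)
  then have "m = - 1" "n = - 1"
    using neg le by (simp_all add: algebra_simps)
  then show "\<beta> \<bullet> \<beta> = \<alpha> \<bullet> \<alpha>" "\<alpha> \<bullet> \<beta> = - (\<alpha> \<bullet> \<alpha>) / 2"
    using mn pos by (simp_all add: cartan_def inner_commute field_simps)
qed

text \<open>The three bonds cancel the three squared lengths, so \<open>a + b + c\<close> would have
  norm 0, contrary to independence.\<close>

lemma simply_laced_no_triangle:
  assumes "simply_laced \<Delta>" "a \<in> \<Delta>" "b \<in> \<Delta>" "c \<in> \<Delta>" "distinct [a, b, c]"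
    and "a \<bullet> b < 0" "b \<bullet> c < 0" "a \<bullet> c < 0"
  shows False
proof -
  have "coef (a + b + c) a \<noteq> 0"
    using assms by (simp add: coef_simps)
  then have "0 < (a + b + c) \<bullet> (a + b + c)"
    using assms by (intro inner_pos_if_coef_nonzero) (auto intro: span_add span_base)
  then show False
    using simply_laced_bond[of a b] simply_laced_bond[of a c] simply_laced_bond[of b c] assms
    by (simp add: inner_add inner_commute)
qed

text \<open>The four bonds cancel the four squared lengths. The diagonals contribute only
  nonpositive terms, so the nonzero vector \<open>a + b + c + d\<close> would have squared norm at
  most 0.\<close>

lemma simply_laced_no_square:
  assumes "simply_laced \<Delta>" "a \<in> \<Delta>" "b \<in> \<Delta>" "c \<in> \<Delta>" "d \<in> \<Delta>" "distinct [a, b, c, d]"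
    and "a \<bullet> b < 0" "b \<bullet> c < 0" "c \<bullet> d < 0" "a \<bullet> d < 0"
  shows False
proof -
  have "coef (a + b + c + d) a \<noteq> 0"
    using assms by (simp add: coef_simps)
  then have "0 < (a + b + c + d) \<bullet> (a + b + c + d)"
    using assms by (intro inner_pos_if_coef_nonzero) (auto intro: span_add span_base)
  moreover have "a \<bullet> c \<le> 0" "b \<bullet> d \<le> 0"
    using assms by (auto intro: simple_obtuse)
  ultimately show False
    using simply_laced_bond[of a b] simply_laced_bond[of b c] simply_laced_bond[of c d]
      simply_laced_bond[of a d] assms
    by (simp add: inner_add inner_commute)
qed

text \<open>The supports {a, b, d} and {a, c, d} are connected. A bond between \<open>b\<close> and
  \<open>c\<close> would join them into a cycle: a triangle on a, b, c or on b, c, d, or a square in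
  the cyclic order a, b, c, d or a, d, b, c.\<close>

lemma star_leaves_orthogonal:
  assumes sl: "simply_laced \<Delta>"
    and mem: "a \<in> \<Delta>" "b \<in> \<Delta>" "c \<in> \<Delta>" "d \<in> \<Delta>" and dist: "distinct [a, b, c, d]"
    and "a + b + d \<in> \<Phi>" "a + c + d \<in> \<Phi>"
  shows "b \<bullet> c = 0"
proof (rule ccontr)
  assume "b \<bullet> c \<noteq> 0"
  then have bc: "b \<bullet> c < 0"
    using simple_obtuse[of b c] mem dist by auto
  have "a \<bullet> b < 0 \<or> b \<bullet> d < 0" "a \<bullet> d < 0 \<or> b \<bullet> d < 0"
    using support_connected3[of b a d] support_connected3[of d a b] assms
    by (auto simp: add_ac inner_commute)
  moreover have "a \<bullet> c < 0 \<or> c \<bullet> d < 0" "a \<bullet> d < 0 \<or> c \<bullet> d < 0"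
    using support_connected3[of c a d] support_connected3[of d a c] assms
    by (auto simp: add_ac inner_commute)
  moreover have "\<not> (a \<bullet> b < 0 \<and> a \<bullet> c < 0)" "\<not> (b \<bullet> d < 0 \<and> c \<bullet> d < 0)"
    using simply_laced_no_triangle[OF sl, of a b c] simply_laced_no_triangle[OF sl, of b c d]
      mem dist bc by auto
  moreover have "\<not> (a \<bullet> b < 0 \<and> c \<bullet> d < 0 \<and> a \<bullet> d < 0)"
    using simply_laced_no_square[OF sl, of a b c d] mem dist bc by auto
  moreover have "\<not> (a \<bullet> d < 0 \<and> b \<bullet> d < 0 \<and> a \<bullet> c < 0)"
    using simply_laced_no_square[OF sl, of a d b c] mem dist bc by (auto simp: inner_commute)
  ultimately show False
    by blast
qed

section \<open>The star: planes through two of the four orthogonal roots\<close>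

lemma star_center_line:
  assumes mem: "a \<in> \<Delta>" "b \<in> \<Delta>" "c \<in> \<Delta>" and dist: "distinct [a, b, c]"
    and prods: "b \<bullet> b = a \<bullet> a" "c \<bullet> c = a \<bullet> a" "a \<bullet> b = - (a \<bullet> a) / 2" "a \<bullet> c = - (a \<bullet> a) / 2" "b \<bullet> c = 0"
    and x: "x = a + b + c" "x \<in> positive_roots \<Phi> \<Delta>"
    and \<gamma>: "p *\<^sub>R a + q *\<^sub>R x \<in> positive_roots \<Phi> \<Delta>"
  shows "p *\<^sub>R a + q *\<^sub>R x \<in> {a, x}"
proof -
  let ?\<gamma> = "p *\<^sub>R a + q *\<^sub>R x"
  have a: "a \<in> \<Phi>" "a \<in> positive_roots \<Phi> \<Delta>" "0 < a \<bullet> a"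
    using mem simple_root simple_positive root_inner_pos by auto
  have bc: "b + c \<notin> \<Phi>"
    using orthogonal_simple_sum_not_root mem dist prods by simp
  have ax: "a \<bullet> x = 0" "x \<bullet> x = a \<bullet> a"
    using prods by (simp_all add: x inner_add inner_commute)
  \<comment> \<open>Reflecting \<open>a + x\<close> in \<open>a\<close> leaves \<open>b + c\<close>,
    a sum of orthogonal simple roots; \<open>a - x\<close> is the negative of the same
    vector.\<close>
  have "a + x \<notin> \<Phi>"
  proof
    assume *: "a + x \<in> \<Phi>"
    have "cartan (a + x) a = 2"
      using a ax by (simp add: cartan_def inner_add inner_commute)
    with reflection_root[OF a(1) *] bc show False
      by (simp add: x scaleR_2)
  qed
  moreover have "a - x \<notin> \<Phi>"
    using bc root_minus[of "a - x"] by (auto simp: x add.commute)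
  moreover have "coef ?\<gamma> b = q" "coef ?\<gamma> a = p + q"
    using mem dist by (auto simp: x coef_simps)
  then have "q \<in> \<int>" "p + q \<in> \<int>"
    using coef_Ints[OF positive_root[OF \<gamma>]] mem by metis+
  moreover from this have "p \<in> \<int>"
    using Ints_diff[of "p + q" q] by simp
  ultimately have "?\<gamma> \<in> {a, - a, x, - x}"
    using root_in_orthogonal_plane a ax positive_root[OF x(2)] positive_root[OF \<gamma>] by metis
  then show ?thesis
    using minus_not_positive a x \<gamma> by (metis insertE insertI1 insertI2 singletonD)
qed

text \<open>Here \<open>x\<close> and \<open>y\<close> are orthogonal of equal length. Reflecting
  \<open>x + y\<close> first in \<open>b\<close> and then in \<open>a\<close> leaves
  \<open>c + d\<close>, a sum of orthogonal simple roots, and \<open>x - y\<close> =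
  \<open>c - d\<close> has mixed signs. The coefficients \<open>p\<close> and \<open>q\<close> are
  read off at \<open>c\<close> and \<open>d\<close>, hence integral.\<close>

lemma star_leaf_line:
  assumes mem: "a \<in> \<Delta>" "b \<in> \<Delta>" "c \<in> \<Delta>" "d \<in> \<Delta>" and dist: "distinct [a, b, c, d]"
    and prods: "b \<bullet> b = a \<bullet> a" "c \<bullet> c = a \<bullet> a" "d \<bullet> d = a \<bullet> a"
      "a \<bullet> b = - (a \<bullet> a) / 2" "a \<bullet> c = - (a \<bullet> a) / 2" "a \<bullet> d = - (a \<bullet> a) / 2"
      "b \<bullet> c = 0" "b \<bullet> d = 0" "c \<bullet> d = 0"
    and x: "x = a + b + c" "x \<in> positive_roots \<Phi> \<Delta>"
    and y: "y = a + b + d" "y \<in> positive_roots \<Phi> \<Delta>"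
    and \<gamma>: "p *\<^sub>R x + q *\<^sub>R y \<in> positive_roots \<Phi> \<Delta>"
  shows "p *\<^sub>R x + q *\<^sub>R y \<in> {x, y}"
proof -
  let ?\<gamma> = "p *\<^sub>R x + q *\<^sub>R y"
  have ab: "a \<in> \<Phi>" "b \<in> \<Phi>" "0 < a \<bullet> a"
    using mem simple_root root_inner_pos by auto
  have cd: "c + d \<notin> \<Phi>"
    using orthogonal_simple_sum_not_root mem dist prods by simp
  have xy: "x \<bullet> y = 0" "x \<bullet> x = a \<bullet> a" "y \<bullet> y = a \<bullet> a"
    using prods by (simp_all add: x y inner_add inner_commute)
  have "x + y \<notin> \<Phi>"
  proof
    assume *: "x + y \<in> \<Phi>"
    have "cartan (x + y) b = 2"
      using ab prods by (simp add: cartan_def x y inner_add inner_commute)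
    moreover have "x + y - 2 *\<^sub>R b = 2 *\<^sub>R a + c + d"
      by (simp add: x y scaleR_2)
    ultimately have *: "2 *\<^sub>R a + c + d \<in> \<Phi>"
      using reflection_root[OF ab(2) *] by simp
    have "cartan (2 *\<^sub>R a + c + d) a = 2"
      using ab prods by (simp add: cartan_def inner_add inner_commute)
    with reflection_root[OF ab(1) *] cd show False
      by (simp add: add.assoc)
  qed
  moreover have "x - y \<notin> \<Phi>"
    using root_no_mixed_signs[of "x - y" c d] mem dist by (auto simp: x y coef_simps)
  moreover have "coef ?\<gamma> c = p" "coef ?\<gamma> d = q"
    using mem dist by (auto simp: x y coef_simps)
  then have "p \<in> \<int>" "q \<in> \<int>"
    using coef_Ints[OF positive_root[OF \<gamma>]] mem by metis+
  ultimately have "?\<gamma> \<in> {x, - x, y, - y}"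
    using root_in_orthogonal_plane xy positive_root[OF x(2)] positive_root[OF y(2)]
      positive_root[OF \<gamma>] by metis
  then show ?thesis
    using minus_not_positive x y \<gamma> by (metis insertE insertI1 insertI2 singletonD)
qed

lemma star_ideal_not_line_closed:
  assumes sl: "simply_laced \<Delta>" and star: "star_ideal \<Phi> \<Delta> I"
  shows "\<not> line_closed I"
proof -
  \<comment> \<open>The centre \<open>a\<close> is the simple root that occurs in all three
    sums.\<close>
  obtain a b c d where mem: "a \<in> \<Delta>" "b \<in> \<Delta>" "c \<in> \<Delta>" "d \<in> \<Delta>" and dist: "distinct [a, b, c, d]"
    and in_I: "a + b + c \<in> I" "a + b + d \<in> I" "a + c + d \<in> I"
    using star unfolding star_ideal_def by (auto simp: add_ac)
  have ideal: "order_ideal \<Phi> \<Delta> I"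
    using star by (simp add: star_ideal_def)
  note pos = in_I[THEN ideal_positive[OF ideal]]
  note roots = pos[THEN positive_root]
  \<comment> \<open>Each pair of leaves uses the two sums that contain only one of the pair.\<close>
  have orth: "b \<bullet> c = 0" "b \<bullet> d = 0" "c \<bullet> d = 0"
    using star_leaves_orthogonal[OF sl, of a b c d] star_leaves_orthogonal[OF sl, of a b d c]
      star_leaves_orthogonal[OF sl, of a c d b] mem dist roots
    by (auto simp: add_ac)
  \<comment> \<open>With the leaves mutually orthogonal, connectedness of the supports ties each
    leaf to the centre.\<close>
  have "a \<bullet> b < 0" "a \<bullet> c < 0" "a \<bullet> d < 0"
    using support_connected3[of b a c] support_connected3[of c a b] support_connected3[of d a b]
      mem dist roots orth by (auto simp: add_ac inner_commute)
  then have prods: "b \<bullet> b = a \<bullet> a" "c \<bullet> c = a \<bullet> a" "d \<bullet> d = a \<bullet> a"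
      "a \<bullet> b = - (a \<bullet> a) / 2" "a \<bullet> c = - (a \<bullet> a) / 2" "a \<bullet> d = - (a \<bullet> a) / 2"
    using simply_laced_bond[OF sl mem(1,2)] simply_laced_bond[OF sl mem(1,3)]
      simply_laced_bond[OF sl mem(1,4)] dist by auto
  have ab_in_I: "a \<in> I" "b \<in> I"
    using mem dist
    by (auto intro!: ideal_downward[OF ideal in_I(1)] simple_positive simp: coef_simps)
  let ?x = "a + b + c" and ?y = "a + b + d" and ?z = "a + c + d"
  let ?S = "{a, ?x, ?y, ?z}"
  have center: "p *\<^sub>R a + q *\<^sub>R v \<in> ?S" if "v \<in> {?x, ?y, ?z}" "p *\<^sub>R a + q *\<^sub>R v \<in> I" for p q v
  proof -
    have "p *\<^sub>R a + q *\<^sub>R v \<in> {a, v}"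
      using that(1)
    proof (elim insertE emptyE)
      assume "v = ?x" then show ?thesis
        using mem dist prods orth pos ideal_positive[OF ideal that(2)]
        by (intro star_center_line[of a b c]) auto
    next
      assume "v = ?y" then show ?thesis
        using mem dist prods orth pos ideal_positive[OF ideal that(2)]
        by (intro star_center_line[of a b d]) auto
    next
      assume "v = ?z" then show ?thesis
        using mem dist prods orth pos ideal_positive[OF ideal that(2)]
        by (intro star_center_line[of a c d]) auto
    qed
    then show ?thesis
      using that(1) by blast
  qed
  have leaf: "p *\<^sub>R v + q *\<^sub>R w \<in> ?S"
    if "(v, w) \<in> {(?x, ?y), (?x, ?z), (?y, ?z)}" "p *\<^sub>R v + q *\<^sub>R w \<in> I" for p q v w
  proof -
    have "p *\<^sub>R v + q *\<^sub>R w \<in> {v, w}"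
      using that(1)
    proof (elim insertE emptyE Pair_inject)
      assume "v = ?x" "w = ?y" then show ?thesis
        using mem dist prods orth pos ideal_positive[OF ideal that(2)]
        by (intro star_leaf_line[of a b c d]) (auto simp: add_ac)
    next
      assume "v = ?x" "w = ?z" then show ?thesis
        using mem dist prods orth pos ideal_positive[OF ideal that(2)]
        by (intro star_leaf_line[of a c b d]) (auto simp: add_ac inner_commute)
    next
      assume "v = ?y" "w = ?z" then show ?thesis
        using mem dist prods orth pos ideal_positive[OF ideal that(2)]
        by (intro star_leaf_line[of a d b c]) (auto simp: add_ac inner_commute)
    qed
    then show ?thesis
      using that(1) by blast
  qed
  show ?thesis
  proof (rule not_line_closedI)
    show "?S \<subseteq> I"
      using in_I ab_in_I by simp
    show "b \<in> I"
      by (rule ab_in_I)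
    \<comment> \<open>In \<open>?x + ?y - ?z - a\<close> everything cancels except twice
      \<open>b\<close>.\<close>
    have "b = (1/2) *\<^sub>R (?x + ?y - ?z - a)"
      by (simp add: scaleR_2[symmetric])
    then show "b \<in> span ?S"
      by (metis insertI1 insertI2 span_add span_base span_diff span_scale)
    have "coef b b \<noteq> coef a b" "coef b a \<noteq> coef ?x a" "coef b a \<noteq> coef ?y a" "coef b a \<noteq> coef ?z a"
      using mem dist by (auto simp: coef_simps)
    then show "b \<notin> ?S"
      by (metis insertE emptyE)
  next
    fix v w p q
    assume "v \<in> ?S" "w \<in> ?S" and I: "p *\<^sub>R v + q *\<^sub>R w \<in> I"
    then consider "v = w" | "v = a" "w \<in> {?x, ?y, ?z}" | "w = a" "v \<in> {?x, ?y, ?z}"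
      | "(v, w) \<in> {(?x, ?y), (?x, ?z), (?y, ?z)}" | "(w, v) \<in> {(?x, ?y), (?x, ?z), (?y, ?z)}"
      by auto
    then show "p *\<^sub>R v + q *\<^sub>R w \<in> ?S"
    proof cases
      \<comment> \<open>The plane degenerates to a line; reducedness and positivity leave only
        \<open>v\<close> itself.\<close>
      case 1
      have "v \<in> positive_roots \<Phi> \<Delta>"
        using \<open>v \<in> ?S\<close> pos simple_positive[OF mem(1)] by auto
      moreover have "(p + q) *\<^sub>R v \<in> positive_roots \<Phi> \<Delta>"
        using ideal_positive[OF ideal I] 1 by (simp add: scaleR_add_left)
      ultimately have "(p + q) *\<^sub>R v = v"
        using root_multiple[of v "p + q"] positive_root minus_not_positive by metis
      then show ?thesis
        using \<open>v \<in> ?S\<close> 1 by (simp add: scaleR_add_left)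
    next
      case 2
      then show ?thesis using center I by blast
    next
      case 3
      then show ?thesis using center[of v q p] I by (simp only: add.commute)
    next
      case 4
      then show ?thesis using leaf I by blast
    next
      case 5
      then show ?thesis using leaf[of w v q p] I by (simp only: add.commute)
    qed
  qed
qed

end

section \<open>Small values of integral quadratic forms\<close>

lemma abs_le_2_if_square_le_8:
  fixes k m :: int
  assumes "k\<^sup>2 + m \<le> 8" "0 \<le> m"
  shows "\<bar>k\<bar> \<le> 2"
proof (rule ccontr)
  assume "\<not> ?thesis"
  then have "3\<^sup>2 \<le> \<bar>k\<bar>\<^sup>2"
    by (intro power_mono) auto
  then show False
    using assms by simp
qed

text \<open>The left side is four times the form
  \<open>c\<^sup>2 - 3 * c * d + 3 * d\<^sup>2\<close> after completing the square; it is the norm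
  form of both \<open>A\<^sub>2\<close> planes used below, up to scale. The second square gives d
  \<le> 1, and the first then bounds \<open>c\<close>.\<close>

lemma A2_form_le_2:
  fixes c d :: nat
  assumes "(2 * int c - 3 * int d)\<^sup>2 + 3 * (int d)\<^sup>2 \<le> 8"
  shows "(c, d) \<in> {(0, 0), (1, 0), (1, 1), (2, 1)}"
proof -
  have c: "\<bar>2 * int c - 3 * int d\<bar> \<le> 2"
    using abs_le_2_if_square_le_8[OF assms] by simp
  have "3 * (int d)\<^sup>2 \<le> 8"
    using assms zero_le_power2[of "2 * int c - 3 * int d"] by linarith
  then have "(int d)\<^sup>2 < 2\<^sup>2"
    by simp
  then have "d < 2"
    using power2_less_imp_less[of "int d" 2] by simp
  then consider "d = 0" | "d = 1"
    by linarith
  then show ?thesis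
  proof cases
    case 1
    then have "c = 0 \<or> c = 1"
      using c by auto
    then show ?thesis using 1 by auto
  next
    case 2
    then have "c = 1 \<or> c = 2"
      using c by auto
    then show ?thesis using 2 by auto
  qed
qed

section \<open>Inner products and coordinates in type \<open>F\<^sub>4\<close>\<close>

locale F4_root_system = based_root_system +
  fixes \<alpha>\<^sub>1 \<alpha>\<^sub>2 \<alpha>\<^sub>3 \<alpha>\<^sub>4 :: "'a::euclidean_space"
  assumes F4: "F4_labelling \<Delta> \<alpha>\<^sub>1 \<alpha>\<^sub>2 \<alpha>\<^sub>3 \<alpha>\<^sub>4"
begin

text \<open>The squared length of the short simple roots, kept as a free scale because root systems
  are not normalized.\<close>

definition N :: real where "N = \<alpha>\<^sub>1 \<bullet> \<alpha>\<^sub>1"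

text \<open>Coordinates in the simple basis. The simplification rules below turn vector identities
  into arithmetic on quadruples; the entries are real because span witnesses need fractions.\<close>

definition comb :: "real \<Rightarrow> real \<Rightarrow> real \<Rightarrow> real \<Rightarrow> 'a" where
  "comb a b c d = a *\<^sub>R \<alpha>\<^sub>1 + b *\<^sub>R \<alpha>\<^sub>2 + c *\<^sub>R \<alpha>\<^sub>3 + d *\<^sub>R \<alpha>\<^sub>4"

lemma Delta: "\<Delta> = {\<alpha>\<^sub>1, \<alpha>\<^sub>2, \<alpha>\<^sub>3, \<alpha>\<^sub>4}"
  and neq: "\<alpha>\<^sub>1 \<noteq> \<alpha>\<^sub>2" "\<alpha>\<^sub>1 \<noteq> \<alpha>\<^sub>3" "\<alpha>\<^sub>1 \<noteq> \<alpha>\<^sub>4" "\<alpha>\<^sub>2 \<noteq> \<alpha>\<^sub>3" "\<alpha>\<^sub>2 \<noteq> \<alpha>\<^sub>4" "\<alpha>\<^sub>3 \<noteq> \<alpha>\<^sub>4"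
  using F4 by (simp_all add: F4_labelling_def)

lemmas neqs = neq neq[symmetric]

lemma mem: "\<alpha>\<^sub>1 \<in> \<Delta>" "\<alpha>\<^sub>2 \<in> \<Delta>" "\<alpha>\<^sub>3 \<in> \<Delta>" "\<alpha>\<^sub>4 \<in> \<Delta>"
  by (simp_all add: Delta)

lemma N_pos: "0 < N"
  using root_inner_pos simple_root mem by (simp add: N_def)

lemma bonds_eq: "bonds \<alpha> \<beta> = 4 * (\<alpha> \<bullet> \<beta>)\<^sup>2 / ((\<alpha> \<bullet> \<alpha>) * (\<beta> \<bullet> \<beta>))"
  by (simp add: bonds_def cartan_def inner_commute power2_eq_square)

lemma single_bond:
  assumes "\<alpha> \<in> \<Delta>" "\<beta> \<in> \<Delta>" "\<alpha> \<noteq> \<beta>" "\<beta> \<bullet> \<beta> = \<alpha> \<bullet> \<alpha>" "bonds \<alpha> \<beta> = 1"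
  shows "\<alpha> \<bullet> \<beta> = - (\<alpha> \<bullet> \<alpha>) / 2"
proof -
  have pos: "0 < \<alpha> \<bullet> \<alpha>"
    using root_inner_pos simple_root assms by simp
  then have "(2 * (\<alpha> \<bullet> \<beta>))\<^sup>2 = (\<alpha> \<bullet> \<alpha>)\<^sup>2"
    using assms by (simp add: bonds_eq field_simps power2_eq_square)
  then have "2 * (\<alpha> \<bullet> \<beta>) = \<alpha> \<bullet> \<alpha> \<or> 2 * (\<alpha> \<bullet> \<beta>) = - (\<alpha> \<bullet> \<alpha>)"
    by (simp only: power2_eq_iff)
  then show ?thesis
    using simple_obtuse[OF assms(1-3)] pos by auto
qed

lemma no_bond:
  assumes "\<alpha> \<in> \<Delta>" "\<beta> \<in> \<Delta>" "bonds \<alpha> \<beta> = 0"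
  shows "\<alpha> \<bullet> \<beta> = 0"
  using assms root_inner_pos[of \<alpha>] root_inner_pos[of \<beta>] simple_root by (auto simp: bonds_eq)

text \<open>The two Cartan integers are negative with product 2, so they are -1 and -2. The
  inequality between the lengths of \<open>\<alpha>\<^sub>2\<close> and
  \<open>\<alpha>\<^sub>3\<close> decides which is which.\<close>

lemma double_bond: "\<alpha>\<^sub>2 \<bullet> \<alpha>\<^sub>3 = - (\<alpha>\<^sub>2 \<bullet> \<alpha>\<^sub>2)" "\<alpha>\<^sub>3 \<bullet> \<alpha>\<^sub>3 = 2 * (\<alpha>\<^sub>2 \<bullet> \<alpha>\<^sub>2)"
proof -
  have pos: "0 < \<alpha>\<^sub>2 \<bullet> \<alpha>\<^sub>2" "0 < \<alpha>\<^sub>3 \<bullet> \<alpha>\<^sub>3"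
    using mem root_inner_pos simple_root by auto
  obtain m n where mn: "cartan \<alpha>\<^sub>2 \<alpha>\<^sub>3 = of_int m" "cartan \<alpha>\<^sub>3 \<alpha>\<^sub>2 = of_int n"
    using cartan_Ints mem simple_root by (metis Ints_cases)
  have short: "\<alpha>\<^sub>2 \<bullet> \<alpha>\<^sub>2 < \<alpha>\<^sub>3 \<bullet> \<alpha>\<^sub>3"
    using F4 by (simp add: F4_labelling_def norm_eq_sqrt_inner)
  have "of_int m * of_int n = (2 :: real)"
    using F4 mn by (simp add: F4_labelling_def bonds_def)
  then have prod: "m * n = 2"
    by (metis of_int_eq_iff of_int_mult of_int_numeral)
  have eqs: "of_int m * (\<alpha>\<^sub>3 \<bullet> \<alpha>\<^sub>3) = 2 * (\<alpha>\<^sub>2 \<bullet> \<alpha>\<^sub>3)" "of_int n * (\<alpha>\<^sub>2 \<bullet> \<alpha>\<^sub>2) = 2 * (\<alpha>\<^sub>2 \<bullet> \<alpha>\<^sub>3)"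
    using mn pos by (simp_all add: cartan_def inner_commute field_simps)
  have "\<alpha>\<^sub>2 \<bullet> \<alpha>\<^sub>3 \<le> 0"
    using simple_obtuse mem neq by blast
  then have "of_int n * (\<alpha>\<^sub>2 \<bullet> \<alpha>\<^sub>2) \<le> 0"
    using eqs by simp
  then have "n \<le> 0"
    using pos by (simp add: mult_le_0_iff)
  moreover have "n dvd 2"
    using prod by (metis dvd_triv_right)
  then have "\<bar>n\<bar> \<le> 2"
    using dvd_imp_le_int[of 2 n] by simp
  moreover have "n \<noteq> 0"
    using prod by auto
  ultimately have "n = - 1 \<or> n = - 2"
    by arith
  then have "m = - 1 \<and> n = - 2"
  proof
    assume "n = - 1"
    then have "m = - 2"
      using prod by simp
    then show ?thesis
      using eqs short pos \<open>n = - 1\<close> by simp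
  qed (use prod in simp)
  then show "\<alpha>\<^sub>2 \<bullet> \<alpha>\<^sub>3 = - (\<alpha>\<^sub>2 \<bullet> \<alpha>\<^sub>2)" "\<alpha>\<^sub>3 \<bullet> \<alpha>\<^sub>3 = 2 * (\<alpha>\<^sub>2 \<bullet> \<alpha>\<^sub>2)"
    using eqs by simp_all
qed

lemma simple_inner:
  "\<alpha>\<^sub>1 \<bullet> \<alpha>\<^sub>1 = N" "\<alpha>\<^sub>2 \<bullet> \<alpha>\<^sub>2 = N" "\<alpha>\<^sub>3 \<bullet> \<alpha>\<^sub>3 = 2 * N" "\<alpha>\<^sub>4 \<bullet> \<alpha>\<^sub>4 = 2 * N"
  "\<alpha>\<^sub>1 \<bullet> \<alpha>\<^sub>2 = - N / 2" "\<alpha>\<^sub>2 \<bullet> \<alpha>\<^sub>3 = - N" "\<alpha>\<^sub>3 \<bullet> \<alpha>\<^sub>4 = - N"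
  "\<alpha>\<^sub>1 \<bullet> \<alpha>\<^sub>3 = 0" "\<alpha>\<^sub>1 \<bullet> \<alpha>\<^sub>4 = 0" "\<alpha>\<^sub>2 \<bullet> \<alpha>\<^sub>4 = 0"
proof -
  show 1: "\<alpha>\<^sub>1 \<bullet> \<alpha>\<^sub>1 = N"
    by (simp add: N_def)
  have "\<alpha>\<^sub>1 \<bullet> \<alpha>\<^sub>1 = \<alpha>\<^sub>2 \<bullet> \<alpha>\<^sub>2" "\<alpha>\<^sub>3 \<bullet> \<alpha>\<^sub>3 = \<alpha>\<^sub>4 \<bullet> \<alpha>\<^sub>4"
    using F4 by (simp_all add: F4_labelling_def norm_eq_sqrt_inner)
  then show 2: "\<alpha>\<^sub>2 \<bullet> \<alpha>\<^sub>2 = N" and 3: "\<alpha>\<^sub>3 \<bullet> \<alpha>\<^sub>3 = 2 * N" and 4: "\<alpha>\<^sub>4 \<bullet> \<alpha>\<^sub>4 = 2 * N"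
    using 1 double_bond by simp_all
  show "\<alpha>\<^sub>1 \<bullet> \<alpha>\<^sub>2 = - N / 2" "\<alpha>\<^sub>3 \<bullet> \<alpha>\<^sub>4 = - N"
    using single_bond[of \<alpha>\<^sub>1 \<alpha>\<^sub>2] single_bond[of \<alpha>\<^sub>3 \<alpha>\<^sub>4] mem neq 1 2 3 4 F4
    by (simp_all add: F4_labelling_def)
  show "\<alpha>\<^sub>2 \<bullet> \<alpha>\<^sub>3 = - N"
    using double_bond 2 by simp
  show "\<alpha>\<^sub>1 \<bullet> \<alpha>\<^sub>3 = 0" "\<alpha>\<^sub>1 \<bullet> \<alpha>\<^sub>4 = 0" "\<alpha>\<^sub>2 \<bullet> \<alpha>\<^sub>4 = 0"
    using F4 no_bond mem by (simp_all add: F4_labelling_def)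
qed

lemma comb_inner:
  "comb a b c d \<bullet> comb a' b' c' d' = N * (a * a' + b * b' + 2 * c * c' + 2 * d * d'
     - (a * b' + a' * b) / 2 - (b * c' + b' * c) - (c * d' + c' * d))"
  unfolding comb_def
  by (simp add: inner_add_left inner_add_right simple_inner
      inner_commute[of \<alpha>\<^sub>2 \<alpha>\<^sub>1] inner_commute[of \<alpha>\<^sub>3 \<alpha>\<^sub>1] inner_commute[of \<alpha>\<^sub>4 \<alpha>\<^sub>1]
      inner_commute[of \<alpha>\<^sub>3 \<alpha>\<^sub>2] inner_commute[of \<alpha>\<^sub>4 \<alpha>\<^sub>2] inner_commute[of \<alpha>\<^sub>4 \<alpha>\<^sub>3])
    (simp add: algebra_simps)

lemma comb_coef [simp]:
  "coef (comb a b c d) \<alpha>\<^sub>1 = a" "coef (comb a b c d) \<alpha>\<^sub>2 = b"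
  "coef (comb a b c d) \<alpha>\<^sub>3 = c" "coef (comb a b c d) \<alpha>\<^sub>4 = d"
  using mem neqs by (simp_all add: comb_def coef_simps)

lemma comb_inject [simp]:
  "comb a b c d = comb a' b' c' d' \<longleftrightarrow> a = a' \<and> b = b' \<and> c = c' \<and> d = d'"
  by (metis comb_coef)

lemma comb_simps [simp]:
  "comb a b c d + comb a' b' c' d' = comb (a + a') (b + b') (c + c') (d + d')"
  "comb a b c d - comb a' b' c' d' = comb (a - a') (b - b') (c - c') (d - d')"
  "r *\<^sub>R comb a b c d = comb (r * a) (r * b) (r * c) (r * d)"
  by (simp_all add: comb_def algebra_simps)

lemma comb_simple: "\<alpha>\<^sub>1 = comb 1 0 0 0" "\<alpha>\<^sub>2 = comb 0 1 0 0" "\<alpha>\<^sub>3 = comb 0 0 1 0" "\<alpha>\<^sub>4 = comb 0 0 0 1"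
  by (simp_all add: comb_def)

lemma height_comb: "height \<Delta> (comb a b c d) = a + b + c + d"
proof -
  have "height \<Delta> (comb a b c d) = (\<Sum>\<alpha>\<in>{\<alpha>\<^sub>1, \<alpha>\<^sub>2, \<alpha>\<^sub>3, \<alpha>\<^sub>4}. coef (comb a b c d) \<alpha>)"
    by (simp only: height_def Delta[symmetric])
  then show ?thesis
    using neqs by simp
qed

lemma root_le_comb:
  "root_le \<Delta> (comb a b c d) (comb a' b' c' d') \<longleftrightarrow> a \<le> a' \<and> b \<le> b' \<and> c \<le> c' \<and> d \<le> d'"
proof -
  have "root_le \<Delta> (comb a b c d) (comb a' b' c' d') \<longleftrightarrow>
    (\<forall>\<alpha>\<in>{\<alpha>\<^sub>1, \<alpha>\<^sub>2, \<alpha>\<^sub>3, \<alpha>\<^sub>4}. coef (comb a b c d) \<alpha> \<le> coef (comb a' b' c' d') \<alpha>)"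
    by (simp only: root_le_def Delta[symmetric])
  then show ?thesis
    by simp
qed

lemma root_comb: "\<gamma> \<in> \<Phi> \<Longrightarrow> \<gamma> = comb (coef \<gamma> \<alpha>\<^sub>1) (coef \<gamma> \<alpha>\<^sub>2) (coef \<gamma> \<alpha>\<^sub>3) (coef \<gamma> \<alpha>\<^sub>4)"
proof -
  assume "\<gamma> \<in> \<Phi>"
  then have "(\<Sum>\<alpha>\<in>{\<alpha>\<^sub>1, \<alpha>\<^sub>2, \<alpha>\<^sub>3, \<alpha>\<^sub>4}. coef \<gamma> \<alpha> *\<^sub>R \<alpha>) = \<gamma>"
    unfolding Delta[symmetric] by (rule root_expansion)
  then show ?thesis
    using neqs by (simp add: comb_def add.assoc)
qed

section \<open>Positive roots through a norm equation, and the two descriptions of the ideal\<close>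

lemma positive_root_inner: "\<gamma> \<in> positive_roots \<Phi> \<Delta> \<Longrightarrow> \<gamma> \<bullet> \<gamma> = N \<or> \<gamma> \<bullet> \<gamma> = 2 * N"
  using positive_root_norm[of \<gamma>] simple_inner by (auto simp: Delta)

text \<open>The integral form is \<gamma> \<bullet> \<gamma> divided by \<open>N\<close>. Each
  positive root has the length of a simple root, so the value is 1 or 2. This necessary condition
  replaces an enumeration of the positive roots.\<close>

lemma positive_root_cases:
  assumes "\<gamma> \<in> positive_roots \<Phi> \<Delta>"
  obtains a b c d :: nat where "\<gamma> = comb a b c d"
    "(int a)\<^sup>2 + (int b)\<^sup>2 + 2 * (int c)\<^sup>2 + 2 * (int d)\<^sup>2 - int a * int b - 2 * int b * int c
      - 2 * int c * int d \<in> {1, 2}"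
proof -
  obtain a b c d :: nat where
    "coef \<gamma> \<alpha>\<^sub>1 = a" "coef \<gamma> \<alpha>\<^sub>2 = b" "coef \<gamma> \<alpha>\<^sub>3 = c" "coef \<gamma> \<alpha>\<^sub>4 = d"
    using coef_positive_Nats[OF assms] mem by (metis Nats_cases)
  then have \<gamma>: "\<gamma> = comb a b c d"
    using root_comb[OF positive_root[OF assms]] by simp
  let ?Q = "(int a)\<^sup>2 + (int b)\<^sup>2 + 2 * (int c)\<^sup>2 + 2 * (int d)\<^sup>2 - int a * int b - 2 * int b * int c
      - 2 * int c * int d"
  have "\<gamma> \<bullet> \<gamma> = N * of_int ?Q"
    by (simp add: \<gamma> comb_inner power2_eq_square algebra_simps)
  then have "of_int ?Q = (1 :: real) \<or> of_int ?Q = (2 :: real)"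
    using positive_root_inner[OF assms] N_pos by auto
  then have "?Q \<in> {1, 2}"
    unfolding of_int_eq_1_iff of_int_eq_numeral_iff by simp
  then show ?thesis
    using that \<gamma> by blast
qed

lemma F4_hat_ideal_comb:
  "F4_hat_ideal \<Phi> \<Delta> \<alpha>\<^sub>1 \<alpha>\<^sub>2 \<alpha>\<^sub>3 \<alpha>\<^sub>4 =
     generated_ideal \<Phi> \<Delta> {comb 1 2 1 0, comb 1 1 1 1, comb 0 2 1 1}"
  by (simp add: F4_hat_ideal_def comb_def)

text \<open>A finite evaluation; the explicit ranges let \<open>simp\<close> run through all
  quadruples. The three alternatives say that the quadruple lies below (1, 2, 1, 0), (1, 1, 1, 1) or
  (0, 2, 1, 1).\<close>

lemma F4_roots_low_height:
  "\<forall>a\<in>{0, 1, 2, 3, 4}. \<forall>b\<in>{0, 1, 2, 3, 4}. \<forall>c\<in>{0, 1, 2, 3, 4}. \<forall>d\<in>{0, 1, 2, 3, 4}. a + b + c + d \<le> 4 \<longrightarrow>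
    a\<^sup>2 + b\<^sup>2 + 2 * c\<^sup>2 + 2 * d\<^sup>2 - a * b - 2 * b * c - 2 * c * d \<in> {1, 2 :: int} \<longrightarrow>
    a \<le> 1 \<and> b \<le> 2 \<and> c \<le> 1 \<and> d = 0 \<or> a \<le> 1 \<and> b \<le> 1 \<and> c \<le> 1 \<and> d \<le> 1 \<or>
    a = 0 \<and> b \<le> 2 \<and> c \<le> 1 \<and> d \<le> 1"
  by simp

text \<open>The three generators have height 4, so everything below them has height at most 4. The
  converse is the finite evaluation above.\<close>

lemma F4_hat_ideal_eq:
  "F4_hat_ideal \<Phi> \<Delta> \<alpha>\<^sub>1 \<alpha>\<^sub>2 \<alpha>\<^sub>3 \<alpha>\<^sub>4 = {\<gamma> \<in> positive_roots \<Phi> \<Delta>. height \<Delta> \<gamma> \<le> 4}"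
proof -
  have "(\<exists>\<eta>\<in>{comb 1 2 1 0, comb 1 1 1 1, comb 0 2 1 1}. root_le \<Delta> \<gamma> \<eta>) \<longleftrightarrow> height \<Delta> \<gamma> \<le> 4"
    if pos: "\<gamma> \<in> positive_roots \<Phi> \<Delta>" for \<gamma>
  proof -
    obtain a b c d :: nat where \<gamma>: "\<gamma> = comb a b c d"
      and Q: "(int a)\<^sup>2 + (int b)\<^sup>2 + 2 * (int c)\<^sup>2 + 2 * (int d)\<^sup>2 - int a * int b
        - 2 * int b * int c - 2 * int c * int d \<in> {1, 2}"
      by (rule positive_root_cases[OF pos])
    have height: "height \<Delta> \<gamma> \<le> 4 \<longleftrightarrow> a + b + c + d \<le> 4"
      unfolding \<gamma> height_comb by linarith
    have below: "(\<exists>\<eta>\<in>{comb 1 2 1 0, comb 1 1 1 1, comb 0 2 1 1}. root_le \<Delta> \<gamma> \<eta>) \<longleftrightarrow>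
      a \<le> 1 \<and> b \<le> 2 \<and> c \<le> 1 \<and> d = 0 \<or> a \<le> 1 \<and> b \<le> 1 \<and> c \<le> 1 \<and> d \<le> 1 \<or>
      a = 0 \<and> b \<le> 2 \<and> c \<le> 1 \<and> d \<le> 1"
      unfolding \<gamma> by (auto simp: root_le_comb)
    have small: "int k \<in> {0, 1, 2, 3, 4}" if "k \<le> 4" for k
      using that by auto
    have "a + b + c + d \<le> 4 \<Longrightarrow>
      a \<le> 1 \<and> b \<le> 2 \<and> c \<le> 1 \<and> d = 0 \<or> a \<le> 1 \<and> b \<le> 1 \<and> c \<le> 1 \<and> d \<le> 1 \<or>
      a = 0 \<and> b \<le> 2 \<and> c \<le> 1 \<and> d \<le> 1"
      using F4_roots_low_height[rule_format, OF small small small small, of a b c d] Q by simp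
    then show ?thesis
      unfolding height below by (intro iffI) linarith+
  qed
  then show ?thesis
    unfolding F4_hat_ideal_comb generated_ideal_def by blast
qed

section \<open>The subsystem of type \<open>A\<^sub>2 \<times> A\<^sub>2\<close>\<close>

lemma comb_root:
  "comb 0 0 1 0 \<in> \<Phi>" "comb 0 2 1 1 \<in> \<Phi>" "comb 1 2 1 0 \<in> \<Phi>" "comb 1 1 1 1 \<in> \<Phi>"
proof -
  have simple: "comb 1 0 0 0 \<in> \<Phi>" "comb 0 1 0 0 \<in> \<Phi>" "comb 0 0 1 0 \<in> \<Phi>" "comb 0 0 0 1 \<in> \<Phi>"
    using mem simple_root by (simp_all flip: comb_simple)
  note reflect = reflection_root[OF simple(1)] reflection_root[OF simple(2)]
    reflection_root[OF simple(3)] reflection_root[OF simple(4)]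
  show "comb 0 0 1 0 \<in> \<Phi>"
    by (rule simple)
  \<comment> \<open>Two chains of simple reflections: one starts at \<open>\<alpha>\<^sub>3\<close>
    and runs through long roots, the other starts at \<open>\<alpha>\<^sub>2\<close> and runs
    through short roots, branching at its last step.\<close>
  have "comb 0 2 1 0 \<in> \<Phi>"
    using reflect(2)[OF simple(3)] N_pos by (simp add: cartan_def comb_inner)
  then show "comb 0 2 1 1 \<in> \<Phi>"
    using reflect(4) N_pos by (fastforce simp: cartan_def comb_inner)
  have "comb 1 1 0 0 \<in> \<Phi>"
    using reflect(1)[OF simple(2)] N_pos by (simp add: cartan_def comb_inner)
  then have *: "comb 1 1 1 0 \<in> \<Phi>"
    using reflect(3)[of "comb 1 1 0 0"] N_pos by (simp add: cartan_def comb_inner)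
  show "comb 1 2 1 0 \<in> \<Phi>"
    using reflect(2)[OF *] N_pos by (simp add: cartan_def comb_inner)
  show "comb 1 1 1 1 \<in> \<Phi>"
    using reflect(4)[OF *] N_pos by (simp add: cartan_def comb_inner)
qed

text \<open>The long factor; its third element is the sum of the other two. Its plane has the
  equations a = 0 and b = 2d.\<close>

definition long_roots :: "'a set" where
  "long_roots = {comb 0 0 1 0, comb 0 2 1 1, comb 0 2 2 1}"

text \<open>The short factor, built the same way in the plane c = a, b = 2a - d, which is orthogonal
  to the long one.\<close>

definition short_roots :: "'a set" where
  "short_roots = {comb 1 2 1 0, comb 1 1 1 1, comb 2 3 2 1}"

text \<open>On this plane the norm form is twice the form of \<open>A2_form_le_2\<close>, whose
  nonzero small solutions are exactly the three listed roots.\<close>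

lemma long_plane:
  assumes "x \<in> long_roots" "y \<in> long_roots" and pos: "p *\<^sub>R x + q *\<^sub>R y \<in> positive_roots \<Phi> \<Delta>"
  shows "p *\<^sub>R x + q *\<^sub>R y \<in> long_roots"
proof -
  let ?\<gamma> = "p *\<^sub>R x + q *\<^sub>R y"
  obtain a b c d :: nat where \<gamma>: "?\<gamma> = comb a b c d"
    and Q: "(int a)\<^sup>2 + (int b)\<^sup>2 + 2 * (int c)\<^sup>2 + 2 * (int d)\<^sup>2 - int a * int b
      - 2 * int b * int c - 2 * int c * int d \<in> {1, 2}"
    by (rule positive_root_cases[OF pos])
  have "coef ?\<gamma> \<alpha>\<^sub>1 = 0" "coef ?\<gamma> \<alpha>\<^sub>2 = 2 * coef ?\<gamma> \<alpha>\<^sub>4"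
    using assms(1,2) by (auto simp: long_roots_def)
  then have ab: "a = 0" "b = 2 * d"
    unfolding \<gamma> by simp_all
  have Q': "6 * (int d)\<^sup>2 + 2 * (int c)\<^sup>2 - 6 * (int c * int d) \<in> {1, 2}"
    using Q by (simp add: ab power2_eq_square algebra_simps)
  moreover have "(2 * int c - 3 * int d)\<^sup>2 + 3 * (int d)\<^sup>2
      = 2 * (6 * (int d)\<^sup>2 + 2 * (int c)\<^sup>2 - 6 * (int c * int d))"
    by (simp add: power2_eq_square algebra_simps)
  ultimately have "(c, d) \<in> {(0, 0), (1, 0), (1, 1), (2, 1)}"
    by (intro A2_form_le_2) auto
  with Q' show ?thesis
    by (auto simp: \<gamma> ab long_roots_def)
qed

text \<open>On this plane the norm form in \<open>a\<close> and \<open>d\<close> is the form of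
  \<open>A2_form_le_2\<close> itself.\<close>

lemma short_plane:
  assumes "x \<in> short_roots" "y \<in> short_roots" and pos: "p *\<^sub>R x + q *\<^sub>R y \<in> positive_roots \<Phi> \<Delta>"
  shows "p *\<^sub>R x + q *\<^sub>R y \<in> short_roots"
proof -
  let ?\<gamma> = "p *\<^sub>R x + q *\<^sub>R y"
  obtain a b c d :: nat where \<gamma>: "?\<gamma> = comb a b c d"
    and Q: "(int a)\<^sup>2 + (int b)\<^sup>2 + 2 * (int c)\<^sup>2 + 2 * (int d)\<^sup>2 - int a * int b
      - 2 * int b * int c - 2 * int c * int d \<in> {1, 2}"
    by (rule positive_root_cases[OF pos])
  have "coef ?\<gamma> \<alpha>\<^sub>3 = coef ?\<gamma> \<alpha>\<^sub>1" "coef ?\<gamma> \<alpha>\<^sub>2 = 2 * coef ?\<gamma> \<alpha>\<^sub>1 - coef ?\<gamma> \<alpha>\<^sub>4"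
    using assms(1,2) by (auto simp: short_roots_def)
  then have "c = a" and b: "real b = 2 * real a - real d"
    \<comment> \<open>The equation for \<open>b\<close> is kept over the reals, then the integers,
      since subtraction of naturals truncates.\<close>
    unfolding \<gamma> by simp_all
  moreover from b have "int b = 2 * int a - int d"
    by linarith
  ultimately have bc: "c = a" "int b = 2 * int a - int d"
    by simp_all
  have Q': "(int a)\<^sup>2 - 3 * (int a * int d) + 3 * (int d)\<^sup>2 \<in> {1, 2}"
    using Q by (simp add: bc power2_eq_square algebra_simps)
  moreover have "(2 * int a - 3 * int d)\<^sup>2 + 3 * (int d)\<^sup>2
      = 4 * ((int a)\<^sup>2 - 3 * (int a * int d) + 3 * (int d)\<^sup>2)"
    by (simp add: power2_eq_square algebra_simps)
  ultimately have ad: "(a, d) \<in> {(0, 0), (1, 0), (1, 1), (2, 1)}"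
    by (intro A2_form_le_2) auto
  with Q' b show ?thesis
    by (auto simp: \<gamma> bc(1) short_roots_def)
qed

text \<open>The orthogonal roots \<open>x\<close> and \<open>y\<close> have squared lengths
  \<open>2 * N\<close> and \<open>N\<close>, so the Cartan integers of the combination are i = 2p
  and j = 2q. The two possible root lengths give \<open>2 * i\<^sup>2 + j\<^sup>2\<close> the value
  4 or 8, whose only integer solutions are (0, \<plusminus>2) and (\<plusminus>2, 0).\<close>

lemma mixed_plane:
  assumes x: "x \<in> long_roots" and y: "y \<in> short_roots"
    and pos: "x \<in> positive_roots \<Phi> \<Delta>" "y \<in> positive_roots \<Phi> \<Delta>"
      "p *\<^sub>R x + q *\<^sub>R y \<in> positive_roots \<Phi> \<Delta>"
  shows "p *\<^sub>R x + q *\<^sub>R y \<in> {x, y}"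
proof -
  let ?\<gamma> = "p *\<^sub>R x + q *\<^sub>R y"
  have inner: "x \<bullet> x = 2 * N" "y \<bullet> y = N" "x \<bullet> y = 0"
    using x y by (auto simp: long_roots_def short_roots_def comb_inner)
  have "cartan ?\<gamma> x = 2 * p" "cartan ?\<gamma> y = 2 * q"
    using inner N_pos by (simp_all add: cartan_def inner_add inner_commute)
  then obtain i j :: int where ij: "2 * p = i" "2 * q = j"
    using cartan_Ints pos positive_root by (metis Ints_cases)
  have "4 * (?\<gamma> \<bullet> ?\<gamma>) = N * (2 * (2 * p)\<^sup>2 + (2 * q)\<^sup>2)"
    using inner by (simp add: inner_add inner_commute power2_eq_square algebra_simps)
  also have "\<dots> = N * of_int (2 * i\<^sup>2 + j\<^sup>2)"
    by (simp add: ij)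
  finally have "of_int (2 * i\<^sup>2 + j\<^sup>2) = (4 :: real) \<or> of_int (2 * i\<^sup>2 + j\<^sup>2) = (8 :: real)"
    using positive_root_inner[OF pos(3)] N_pos by auto
  then have Q: "2 * i\<^sup>2 + j\<^sup>2 = 4 \<or> 2 * i\<^sup>2 + j\<^sup>2 = 8"
    unfolding of_int_eq_numeral_iff .
  then have "\<bar>i\<bar> \<le> 2" "\<bar>j\<bar> \<le> 2"
    using abs_le_2_if_square_le_8[of i "i\<^sup>2 + j\<^sup>2"] abs_le_2_if_square_le_8[of j "2 * i\<^sup>2"] by auto
  then have "i \<in> {- 2, - 1, 0, 1, 2}" "j \<in> {- 2, - 1, 0, 1, 2}"
    by auto
  then have "(i, j) \<in> {(0, 2), (0, - 2), (2, 0), (- 2, 0)}"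
    using Q by auto
  then have "(p, q) \<in> {(0, 1), (0, - 1), (1, 0), (- 1, 0)}"
    using ij by auto
  then have "?\<gamma> \<in> {x, - x, y, - y}"
    by auto
  then show ?thesis
    using minus_not_positive pos by (metis insertE insertI1 insertI2 singletonD)
qed

lemma F4_not_line_closed:
  assumes ideal: "order_ideal \<Phi> \<Delta> I" and hat: "F4_hat_ideal \<Phi> \<Delta> \<alpha>\<^sub>1 \<alpha>\<^sub>2 \<alpha>\<^sub>3 \<alpha>\<^sub>4 \<subseteq> I"
  shows "\<not> line_closed I"
proof -
  \<comment> \<open>The third roots of the factors have heights 5 and 8 and need not lie in
    \<open>I\<close>; the other four have height at most 4 and do.\<close>
  let ?S = "I \<inter> (long_roots \<union> short_roots)"
  have in_I: "\<gamma> \<in> I" if "\<gamma> \<in> positive_roots \<Phi> \<Delta>" "height \<Delta> \<gamma> \<le> 4" for \<gamma>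
    using hat that by (auto simp: F4_hat_ideal_eq)
  have pos: "comb 0 0 1 0 \<in> positive_roots \<Phi> \<Delta>" "comb 0 2 1 1 \<in> positive_roots \<Phi> \<Delta>"
    "comb 1 2 1 0 \<in> positive_roots \<Phi> \<Delta>" "comb 1 1 1 1 \<in> positive_roots \<Phi> \<Delta>"
    using comb_root mem by (auto intro: positiveI[of _ \<alpha>\<^sub>3])
  show ?thesis
  proof (rule not_line_closedI)
    show "?S \<subseteq> I"
      by blast
    have "comb 1 0 0 0 \<in> positive_roots \<Phi> \<Delta>"
      using simple_positive[OF mem(1)] by (simp flip: comb_simple)
    then show "comb 1 0 0 0 \<in> I"
      by (intro in_I) (simp_all add: height_comb)
    have S: "comb 0 0 1 0 \<in> ?S" "comb 0 2 1 1 \<in> ?S" "comb 1 2 1 0 \<in> ?S" "comb 1 1 1 1 \<in> ?S"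
      using pos in_I by (simp_all add: long_roots_def short_roots_def height_comb)
    \<comment> \<open>The splitting of \<open>\<alpha>\<^sub>1\<close> into its components in the
      short plane and in the orthogonal long plane.\<close>
    have "comb 1 0 0 0 = (1/3) *\<^sub>R comb 1 2 1 0 + (2/3) *\<^sub>R comb 1 1 1 1
        - (1/3) *\<^sub>R comb 0 0 1 0 - (2/3) *\<^sub>R comb 0 2 1 1"
      by simp
    then show "comb 1 0 0 0 \<in> span ?S"
      using S by (metis span_add span_base span_diff span_scale)
    show "comb 1 0 0 0 \<notin> ?S"
      by (simp add: long_roots_def short_roots_def)
  next
    fix x y p q
    assume x: "x \<in> ?S" and y: "y \<in> ?S" and I: "p *\<^sub>R x + q *\<^sub>R y \<in> I"
    have pos: "x \<in> positive_roots \<Phi> \<Delta>" "y \<in> positive_roots \<Phi> \<Delta>"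
      "p *\<^sub>R x + q *\<^sub>R y \<in> positive_roots \<Phi> \<Delta>"
      using ideal_positive[OF ideal] x y I by blast+
    have pos': "q *\<^sub>R y + p *\<^sub>R x \<in> positive_roots \<Phi> \<Delta>"
      using pos(3) by (simp only: add.commute)
    have "p *\<^sub>R x + q *\<^sub>R y \<in> long_roots \<union> short_roots"
    proof (cases "x \<in> long_roots"; cases "y \<in> long_roots")
      assume "x \<in> long_roots" "y \<in> long_roots"
      then show ?thesis
        using long_plane[OF _ _ pos(3)] by simp
    next
      assume "x \<in> long_roots" "y \<notin> long_roots"
      then show ?thesis
        using mixed_plane[OF _ _ pos(1,2,3)] x y by fastforce
    next
      assume "x \<notin> long_roots" "y \<in> long_roots"
      then show ?thesis
        using mixed_plane[OF _ _ pos(2,1) pos'] x y unfolding add.commute[of "p *\<^sub>R x"]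
        by fastforce
    next
      assume "x \<notin> long_roots" "y \<notin> long_roots"
      then show ?thesis
        using short_plane[OF _ _ pos(3)] x y by simp
    qed
    then show "p *\<^sub>R x + q *\<^sub>R y \<in> ?S"
      using I by blast
  qed
qed

end

theorem proposition8p2:
  fixes \<Phi> \<Delta> I :: "'a::euclidean_space set"
  assumes "root_system \<Phi>"
    and "simple_roots \<Phi> \<Delta>"
    and "order_ideal \<Phi> \<Delta> I"
  shows "(simply_laced \<Delta> \<and> star_ideal \<Phi> \<Delta> I \<longrightarrow> \<not> line_closed I) \<and>
    (\<forall>\<alpha>\<^sub>1 \<alpha>\<^sub>2 \<alpha>\<^sub>3 \<alpha>\<^sub>4. F4_labelling \<Delta> \<alpha>\<^sub>1 \<alpha>\<^sub>2 \<alpha>\<^sub>3 \<alpha>\<^sub>4 \<longrightarrow>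
       F4_hat_ideal \<Phi> \<Delta> \<alpha>\<^sub>1 \<alpha>\<^sub>2 \<alpha>\<^sub>3 \<alpha>\<^sub>4 = {\<gamma> \<in> positive_roots \<Phi> \<Delta>. height \<Delta> \<gamma> \<le> 4} \<and>
       (F4_hat_ideal \<Phi> \<Delta> \<alpha>\<^sub>1 \<alpha>\<^sub>2 \<alpha>\<^sub>3 \<alpha>\<^sub>4 \<subseteq> I \<longrightarrow> \<not> line_closed I))"
proof (intro conjI allI impI)
  interpret based_root_system \<Phi> \<Delta>
    using assms by unfold_locales
  assume "simply_laced \<Delta> \<and> star_ideal \<Phi> \<Delta> I"
  then show "\<not> line_closed I"
    using star_ideal_not_line_closed by blast
next
  fix \<alpha>\<^sub>1 \<alpha>\<^sub>2 \<alpha>\<^sub>3 \<alpha>\<^sub>4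
  assume "F4_labelling \<Delta> \<alpha>\<^sub>1 \<alpha>\<^sub>2 \<alpha>\<^sub>3 \<alpha>\<^sub>4"
  then interpret F4_root_system \<Phi> \<Delta> \<alpha>\<^sub>1 \<alpha>\<^sub>2 \<alpha>\<^sub>3 \<alpha>\<^sub>4
    using assms by unfold_locales
  show "F4_hat_ideal \<Phi> \<Delta> \<alpha>\<^sub>1 \<alpha>\<^sub>2 \<alpha>\<^sub>3 \<alpha>\<^sub>4 = {\<gamma> \<in> positive_roots \<Phi> \<Delta>. height \<Delta> \<gamma> \<le> 4}"
    by (rule F4_hat_ideal_eq)
  show "\<not> line_closed I" if "F4_hat_ideal \<Phi> \<Delta> \<alpha>\<^sub>1 \<alpha>\<^sub>2 \<alpha>\<^sub>3 \<alpha>\<^sub>4 \<subseteq> I"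
    using F4_not_line_closed assms(3) that by blast
qed

end
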